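(* Let $\mathscr O$ be a set of pairwise disjoint line-segment obstacles in $\mathbb{R}^2$, $s$ the starting point, $l>0$ the maximum path length and $\mathscr E'$ the effective endpoint set. Then the achievable region satisfies $$\mathscr R=\bigcup_{e\in\mathscr E'}\mathscr R_{cvr}(e,l-\pi(s,e))\ \cup\ \mathscr R_{cvr}(s,l).$$
   Context: A point object moves in the plane and may not pass through any obstacle; $\pi(p,p')$ is the length of a shortest path from $p$ to $p'$ avoiding the obstacles. The achievable region is $\mathscr R=\{p\in\mathbb{R}^2:\pi(s,p)\le l\}$. $C(p,r)$ is the closed disk of center $p$ and radius $r$. Two points $p,p'$ are visible to each other if the segment $\overline{pp'}$ crosses no obstacle. The circular visibility region $\mathscr R_{cvr}(p,r)$ is the set of points $p'\in C(p,r)$ visible from $p$. The effective endpoint set $\mathscr E'$ is the set of obstacle endpoints $e$ with $\pi(s,e)<l$.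
   Formalization: The set of obstacles is assumed finite (with nondegenerate segments); for infinitely many segments accumulating at a point that is not an endpoint, shortest paths may turn there and the identity fails. *)

theory Defs
  imports "HOL-Analysis.Analysis"
begin

text \<open>An obstacle is the closed segment spanned by a pair of distinct endpoints.
  Obstacle sets are finite: infinitely many segments can accumulate at a point that is not an
  endpoint of any of them, and shortest paths may then turn there.\<close>

type_synonym point = "real^2"
type_synonym obstacle = "point \<times> point"

definition segment_obstacles :: "obstacle set \<Rightarrow> bool" where
  "segment_obstacles \<O> \<longleftrightarrow> finite \<O> \<and> (\<forall>(a, b)\<in>\<O>. a \<noteq> b) \<and>
     pairwise (\<lambda>(a, b) (c, d). disjnt (closed_segment a b) (closed_segment c d)) \<O>"

definition endpoints :: "obstacle set \<Rightarrow> point set" where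
  "endpoints \<O> = fst ` \<O> \<union> snd ` \<O>"

text \<open>
  Obstacles are walls without thickness: a path may touch a wall, slide along it and turn around
  its endpoints, but it may not get from one side of it to the other through its relative interior.
  Hence a path crosses the wall if some subarc joins points strictly on opposite sides
  of the line through the wall and meets that line only in the relative interior of the wall.
\<close>

definition crosses :: "(real \<Rightarrow> point) \<Rightarrow> obstacle \<Rightarrow> bool" where
  "crosses g = (\<lambda>(a, b). \<exists>u v. 0 \<le> u \<and> u < v \<and> v \<le> 1 \<and>
     g u \<notin> affine hull {a, b} \<and> g v \<notin> affine hull {a, b} \<and>
     closed_segment (g u) (g v) \<inter> affine hull {a, b} \<noteq> {} \<and>
     g ` {u..v} \<inter> affine hull {a, b} \<subseteq> open_segment a b)"

definition avoiding_paths :: "obstacle set \<Rightarrow> point \<Rightarrow> point \<Rightarrow> (real \<Rightarrow> point) set" where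
  "avoiding_paths \<O> p q =
     {g. path g \<and> pathstart g = p \<and> pathfinish g = q \<and> (\<forall>w\<in>\<O>. \<not> crosses g w)}"

definition curve_length :: "(real \<Rightarrow> point) \<Rightarrow> ereal" where
  "curve_length g = (SUP ts\<in>{ts. sorted ts \<and> set ts \<subseteq> {0..1}}.
     ereal (\<Sum>i<length ts - 1. dist (g (ts ! i)) (g (ts ! Suc i))))"

text \<open>The infimum makes the distance total; it is the length of a shortest path if there is one.\<close>

definition obstacle_dist :: "obstacle set \<Rightarrow> point \<Rightarrow> point \<Rightarrow> ereal" where
  "obstacle_dist \<O> p q = (INF g\<in>avoiding_paths \<O> p q. curve_length g)"

definition achievable_region :: "obstacle set \<Rightarrow> point \<Rightarrow> real \<Rightarrow> point set" where
  "achievable_region \<O> s l = {p. obstacle_dist \<O> s p \<le> ereal l}"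

definition visible :: "obstacle set \<Rightarrow> point \<Rightarrow> point \<Rightarrow> bool" where
  "visible \<O> p q \<longleftrightarrow> (\<forall>w\<in>\<O>. \<not> crosses (linepath p q) w)"

definition circular_visibility_region :: "obstacle set \<Rightarrow> point \<Rightarrow> real \<Rightarrow> point set" where
  "circular_visibility_region \<O> p r = {q \<in> cball p r. visible \<O> p q}"

definition effective_endpoints :: "obstacle set \<Rightarrow> point \<Rightarrow> real \<Rightarrow> point set" where
  "effective_endpoints \<O> s l = {e \<in> endpoints \<O>. obstacle_dist \<O> s e < ereal l}"

lemma linepath_in_affine:
  assumes "affine L" "linepath p q t1 \<in> L" "linepath p q t2 \<in> L" "t1 \<noteq> t2"
  shows "linepath p q t \<in> L"
proof -
  define c where "c = (t - t1) / (t2 - t1)"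
  have "c * (t2 - t1) = t - t1" using assms(4) by (simp add: c_def)
  then have t: "t = (1 - c) * t1 + c * t2" by (simp add: algebra_simps)
  have "linepath p q t = (1 - c) *\<^sub>R linepath p q t1 + c *\<^sub>R linepath p q t2"
    unfolding t linepath_def by (simp add: algebra_simps)
  then show ?thesis using mem_affine[OF assms(1-3), of "1 - c" c] by simp
qed

text \<open>For straight paths, crossing is the usual proper intersection of segments.\<close>

lemma crosses_linepath_iff:
  "crosses (linepath p q) (a, b) \<longleftrightarrow>
     p \<notin> affine hull {a, b} \<and> q \<notin> affine hull {a, b} \<and> open_segment p q \<inter> open_segment a b \<noteq> {}"
  (is "?l \<longleftrightarrow> ?r")
proof
  let ?L = "affine hull {a, b}" and ?g = "linepath p q"
  have aff: "affine ?L" by (rule affine_affine_hull)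
  {
    assume ?l
    then obtain u v x where uv: "0 \<le> u" "u < v" "v \<le> 1" "?g u \<notin> ?L" "?g v \<notin> ?L"
      and x: "x \<in> closed_segment (?g u) (?g v)" "x \<in> ?L"
      and sub: "?g ` {u..v} \<inter> ?L \<subseteq> open_segment a b"
      unfolding crosses_def by auto
    obtain c where c: "0 \<le> c" "c \<le> 1" "x = (1 - c) *\<^sub>R ?g u + c *\<^sub>R ?g v"
      using x(1) by (auto simp: closed_segment_def)
    define t where "t = (1 - c) * u + c * v"
    have xt: "x = ?g t" unfolding c(3) t_def linepath_def by (simp add: algebra_simps)
    have "t \<in> closed_segment u v" using c unfolding closed_segment_def t_def by auto
    then have tuv: "t \<in> {u..v}" using uv by (simp add: closed_segment_eq_real_ivl)
    have tne: "t \<noteq> u" "t \<noteq> v" using xt x(2) uv by auto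
    then have t01: "0 < t" "t < 1" using tuv uv by auto
    have p: "p \<notin> ?L" using linepath_in_affine[OF aff, of p q 0 t u] uv x(2) xt t01
      by (auto simp: linepath_0')
    have q: "q \<notin> ?L" using linepath_in_affine[OF aff, of p q 1 t u] uv x(2) xt t01
      by (auto simp: linepath_1')
    have "p \<noteq> q" using p x(2) xt by (auto simp: linepath_def algebra_simps simp flip: scaleR_left_distrib)
    then have "x \<in> open_segment p q"
      using t01 xt by (auto simp: in_segment linepath_def)
    moreover have "x \<in> open_segment a b" using sub tuv xt x(2) by auto
    ultimately show ?r using p q by auto
  }
  {
    assume r: ?r
    then obtain x where x: "x \<in> open_segment p q" "x \<in> open_segment a b" by auto
    then obtain t where t: "0 < t" "t < 1" "x = ?g t" by (auto simp: in_segment linepath_def)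
    have "open_segment a b \<subseteq> ?L"
      by (metis convex_hull_subset_affine_hull order_trans segment_convex_hull segment_open_subset_closed)
    then have xL: "x \<in> ?L" using x by auto
    have "?g ` {0..1} \<inter> ?L \<subseteq> open_segment a b"
    proof safe
      fix y assume "?g y \<in> ?L"
      then have "y = t" using linepath_in_affine[OF aff, of p q y t 0] xL t r
        by (auto simp: linepath_0')
      then show "?g y \<in> open_segment a b" using x t by simp
    qed
    moreover have "x \<in> closed_segment p q" using x by (simp add: open_segment_def)
    ultimately have "0 \<le> (0::real) \<and> 0 < (1::real) \<and> 1 \<le> (1::real) \<and> ?g 0 \<notin> ?L \<and> ?g 1 \<notin> ?L \<and>
        closed_segment (?g 0) (?g 1) \<inter> ?L \<noteq> {} \<and> ?g ` {0..1} \<inter> ?L \<subseteq> open_segment a b"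
      using r xL by (auto simp only: linepath_0' linepath_1' zero_less_one order_refl)
    then show ?l unfolding crosses_def prod.case by blast
  }
qed

end

theory Submission
  imports Defs
begin

text \<open>Let \<open>g\<close> be an avoiding path from \<open>s\<close> to \<open>p\<close>, and for each time \<open>t\<close> follow \<open>g\<close> up to \<open>t\<close> and
  then run straight to \<open>p\<close>. If no such shortcut crosses a wall, then \<open>p\<close> is visible from \<open>s\<close>.
  Otherwise let \<open>T\<close> be the supremum of the times at which some wall is crossed. The shortcut at
  \<open>T\<close> is avoiding: crossing a wall is a condition that is open to the right, since \<open>g\<close> itself
  cannot pass through the wall. Being a limit of crossing shortcuts it still touches the wall, so
  its straight part contains an endpoint \<open>e\<close> of the wall. Hence \<open>e\<close> sees \<open>p\<close>, and the distance
  from \<open>s\<close> to \<open>e\<close> plus \<open>|e - p|\<close> is at most the length of \<open>g\<close>. Since there are finitely many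
  endpoints, one of them works for paths of length arbitrarily close to the infimum.\<close>

section \<open>Curve length\<close>

text \<open>Along any partition the differences of \<open>V\<close> telescope, and \<open>V\<close>
  is monotone because distances are nonnegative. Below, lengths are estimated through such majorants
  instead of through additivity of \<open>curve_length\<close>.\<close>

lemma curve_length_le_variation:
  fixes g :: "real \<Rightarrow> point" and V :: "real \<Rightarrow> real"
  assumes V: "\<And>x y. 0 \<le> x \<Longrightarrow> x \<le> y \<Longrightarrow> y \<le> 1 \<Longrightarrow> dist (g x) (g y) \<le> V y - V x"
  shows "curve_length g \<le> ereal (V 1 - V 0)"
  unfolding curve_length_def
proof (rule SUP_least, clarsimp)
  fix ts :: "real list" assume ts: "sorted ts" "set ts \<subseteq> {0..1}"
  have mono: "V x \<le> V y" if "0 \<le> x" "x \<le> y" "y \<le> 1" for x y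
    using V[OF that] zero_le_dist[of "g x" "g y"] by linarith
  show "(\<Sum>i<length ts - Suc 0. dist (g (ts ! i)) (g (ts ! Suc i))) \<le> V 1 - V 0"
  proof (cases "ts = []")
    case True then show ?thesis using mono[of 0 1] by simp
  next
    case False
    then obtain m where m: "length ts = Suc m" by (cases ts) auto
    have rng: "ts ! i \<in> {0..1}" if "i \<le> m" for i
      using that m ts(2) nth_mem[of i ts] by (metis le_imp_less_Suc subsetD)
    have "(\<Sum>i<m. dist (g (ts ! i)) (g (ts ! Suc i))) \<le> (\<Sum>i<m. V (ts ! Suc i) - V (ts ! i))"
    proof (rule sum_mono)
      fix i assume i: "i \<in> {..<m}"
      then have "ts ! i \<le> ts ! Suc i" using ts(1) m by (simp add: sorted_iff_nth_mono)
      then show "dist (g (ts ! i)) (g (ts ! Suc i)) \<le> V (ts ! Suc i) - V (ts ! i)"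
        using V rng[of i] rng[of "Suc i"] i by auto
    qed
    also have "\<dots> = V (ts ! m) - V (ts ! 0)"
      by (rule sum_lessThan_telescope)
    also have "\<dots> \<le> V 1 - V 0"
      using mono[of "ts ! m" 1] mono[of 0 "ts ! 0"] rng[of m] rng[of 0] by auto
    finally show ?thesis using m by simp
  qed
qed

text \<open>The converse: take for \<open>V t\<close> the length of \<open>g\<close> up to time
  \<open>t\<close>, the supremum of the polygon lengths over partitions of
  \<open>{0..t}\<close>.\<close>

lemma variation_of_rectifiable:
  fixes g :: "real \<Rightarrow> point"
  assumes c: "curve_length g \<le> ereal c"
  obtains V :: "real \<Rightarrow> real" where "V 1 - V 0 \<le> c"
    "\<And>x y. 0 \<le> x \<Longrightarrow> x \<le> y \<Longrightarrow> y \<le> 1 \<Longrightarrow> dist (g x) (g y) \<le> V y - V x"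
proof -
  define P where "P ts = (\<Sum>i<length ts - 1. dist (g (ts ! i)) (g (ts ! Suc i)))" for ts
  define A where "A t = {ts. sorted ts \<and> set ts \<subseteq> {0..t::real}}" for t
  define V where "V t = Sup (P ` A t)" for t
  have Pc: "P ts \<le> c" if "ts \<in> A 1" for ts
  proof -
    have "ereal (P ts) \<le> curve_length g"
      unfolding curve_length_def P_def using that by (intro SUP_upper) (simp add: A_def)
    then show ?thesis using c order_trans ereal_less_eq(3) by blast
  qed
  have bdd: "bdd_above (P ` A t)" if "t \<le> 1" for t
  proof -
    have "A t \<subseteq> A 1" using that by (force simp: A_def)
    then show ?thesis using Pc by (intro bdd_aboveI[of _ c]) auto
  qed
  have Nil: "[] \<in> A t" for t by (simp add: A_def)
  have up: "P ts \<le> V t" if "ts \<in> A t" "t \<le> 1" for ts t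
    unfolding V_def using that bdd by (intro cSup_upper) auto
  have "V 1 \<le> c" unfolding V_def using Pc Nil by (intro cSup_least) auto
  moreover have "V 0 \<ge> 0" using up[OF Nil, of 0] by (simp add: P_def)
  moreover have "dist (g x) (g y) \<le> V y - V x" if xy: "0 \<le> x" "x \<le> y" "y \<le> 1" for x y
  proof -
    have "P ts \<le> V y - dist (g x) (g y)" if ts: "ts \<in> A x" for ts
    proof -
      \<comment> \<open>Appending \<open>x\<close> as well as \<open>y\<close> makes the last chord
        exactly \<open>dist (g x) (g y)\<close>, wherever \<open>ts\<close> ends.\<close>
      have in_A: "ts @ [x, y] \<in> A y"
        using ts xy by (force simp: A_def sorted_append)
      have "P ts + dist (g x) (g y) \<le> P (ts @ [x, y])"
      proof (cases "ts = []")
        case True then show ?thesis by (simp add: P_def)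
      next
        case False
        then obtain m where m: "length ts = Suc m" by (cases ts) auto
        have "P (ts @ [x, y]) = P ts + dist (g (ts ! m)) (g x) + dist (g x) (g y)"
          unfolding P_def using m by (simp add: nth_append)
        then show ?thesis by simp
      qed
      also have "\<dots> \<le> V y" using up[OF in_A] xy by simp
      finally show ?thesis by simp
    qed
    then have "V x \<le> V y - dist (g x) (g y)"
      unfolding V_def[of x] using Nil by (intro cSup_least) auto
    then show ?thesis by simp
  qed
  ultimately show ?thesis using that[of V] by simp
qed

section \<open>Bounds for the obstacle distance and for joined paths\<close>

lemma curve_length_nonneg: "0 \<le> curve_length g"
  unfolding curve_length_def by (rule SUP_upper2[of "[]"]) auto

lemma obstacle_dist_nonneg: "0 \<le> obstacle_dist \<O> p q"
  unfolding obstacle_dist_def by (intro INF_greatest curve_length_nonneg)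

lemma obstacle_dist_le:
  assumes "g \<in> avoiding_paths \<O> p q" "curve_length g \<le> c"
  shows "obstacle_dist \<O> p q \<le> c"
  unfolding obstacle_dist_def using assms by (auto intro: INF_lower2[of g])

lemma curve_length_linepath: "curve_length (linepath p q) \<le> ereal (dist p q)"
proof -
  have "dist (linepath p q x) (linepath p q y) \<le> y * dist p q - x * dist p q" if "x \<le> y" for x y
  proof -
    have "linepath p q x - linepath p q y = (y - x) *\<^sub>R (p - q)"
      by (simp add: linepath_def algebra_simps)
    then show ?thesis using that by (simp add: dist_norm left_diff_distrib[symmetric])
  qed
  from curve_length_le_variation[of "linepath p q" "\<lambda>x. x * dist p q", OF this]
  show ?thesis by simp
qed

text \<open>A majorant for the joined path is \<open>V\<close> up to time \<open>t\<close>, run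
  through in the first half of the parameter interval, continued by the arc length of the straight
  piece.\<close>

lemma curve_length_join_linepath:
  fixes g :: "real \<Rightarrow> point" and V :: "real \<Rightarrow> real"
  assumes t: "0 \<le> t" "t \<le> 1"
    and V: "\<And>x y. 0 \<le> x \<Longrightarrow> x \<le> y \<Longrightarrow> y \<le> 1 \<Longrightarrow> dist (g x) (g y) \<le> V y - V x"
  shows "curve_length (subpath 0 t g +++ linepath (g t) q) \<le> ereal (V t - V 0 + dist (g t) q)"
proof -
  define W where "W r = (if r \<le> 1/2 then V (2 * r * t) else V t + (2 * r - 1) * dist (g t) q)" for r
  let ?h = "subpath 0 t g +++ linepath (g t) q"
  have h1: "?h r = g (2 * r * t)" if "r \<le> 1/2" for r
    using that by (simp add: joinpaths_def subpath_def mult_ac)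
  have h2: "?h r = g t + (2 * r - 1) *\<^sub>R (q - g t)" if "r > 1/2" for r
    using that by (simp add: joinpaths_def linepath_def algebra_simps)
  have "dist (?h x) (?h y) \<le> W y - W x" if xy: "0 \<le> x" "x \<le> y" "y \<le> 1" for x y
  proof -
    consider "y \<le> 1/2" | "x \<le> 1/2" "y > 1/2" | "x > 1/2" using xy by linarith
    then show ?thesis
    proof cases
      case 1
      have "2 * x * t \<le> 2 * y * t" "2 * y * t \<le> 1" "0 \<le> 2 * x * t"
        using 1 xy t mult_mono[of "2 * y" 1 t 1] by (auto intro: mult_right_mono)
      then show ?thesis using V[of "2*x*t" "2*y*t"] 1 xy h1[of x] h1[of y] by (simp add: W_def)
    next
      case 2
      have "2 * x * t \<le> t" "0 \<le> 2 * x * t"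
        using 2 xy t mult_right_mono[of "2 * x" 1 t] by auto
      then have "dist (g (2*x*t)) (g t) \<le> V t - V (2*x*t)" using V t by simp
      moreover have "dist (g t) (?h y) = (2 * y - 1) * dist (g t) q"
        using h2[OF 2(2)] 2 by (simp add: dist_norm norm_minus_commute)
      moreover have "dist (?h x) (?h y) \<le> dist (g (2*x*t)) (g t) + dist (g t) (?h y)"
        using h1[OF 2(1)] dist_triangle by simp
      ultimately show ?thesis using 2 by (simp add: W_def)
    next
      case 3
      have "?h y - ?h x = (2 * (y - x)) *\<^sub>R (q - g t)"
        unfolding h2[OF 3] h2[OF less_le_trans[OF 3 xy(2)]] by (simp add: algebra_simps)
      then have "dist (?h x) (?h y) = (2 * (y - x)) * dist (g t) q"
        using xy by (simp add: dist_norm norm_minus_commute[of "?h x"] norm_minus_commute[of "g t"])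
      then show ?thesis using 3 xy by (simp add: W_def algebra_simps)
    qed
  qed
  from curve_length_le_variation[of ?h W, OF this] show ?thesis
    by (simp add: W_def algebra_simps)
qed

section \<open>Crossing a single wall\<close>

text \<open>By the intermediate value theorem, \<open>k\<close> on \<open>{u..v}\<close> runs
  through all of \<open>g\<close> between the times \<open>\<phi> u\<close> and
  \<open>\<phi> v\<close>, so a crossing arc of \<open>k\<close> yields one of \<open>g\<close>.
  Weak monotonicity admits pauses, as in degenerate subpaths.\<close>

lemma crosses_reparametrization:
  assumes k: "crosses k w" "\<And>r. r \<in> {0..1} \<Longrightarrow> k r = g (\<phi> r)"
    and \<phi>: "continuous_on {0..1} \<phi>" "mono_on {0..1} \<phi>" "\<phi> ` {0..1} \<subseteq> {0..1}"
  shows "crosses g w"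
proof -
  obtain a b where w: "w = (a, b)" by fastforce
  let ?L = "affine hull {a, b}"
  obtain u v where uv: "0 \<le> u" "u < v" "v \<le> 1" "k u \<notin> ?L" "k v \<notin> ?L"
     "closed_segment (k u) (k v) \<inter> ?L \<noteq> {}"
     and hits: "k ` {u..v} \<inter> ?L \<subseteq> open_segment a b"
    using k(1) unfolding crosses_def w by auto
  have kuv: "k u = g (\<phi> u)" "k v = g (\<phi> v)" using k(2) uv by auto
  \<comment> \<open>Otherwise the segment from \<open>k u\<close> to \<open>k v\<close> would be a
    single point off the line and could not meet it.\<close>
  have "\<phi> u \<noteq> \<phi> v" using uv kuv by auto
  then have "\<phi> u < \<phi> v" using \<phi>(2) uv by (auto simp: mono_on_def less_le)
  moreover have "0 \<le> \<phi> u" "\<phi> v \<le> 1" using \<phi>(3) uv by (auto simp: image_subset_iff)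
  moreover have "g ` {\<phi> u..\<phi> v} \<inter> ?L \<subseteq> open_segment a b"
  proof clarify
    fix y assume y: "y \<in> {\<phi> u..\<phi> v}" "g y \<in> ?L"
    have "continuous_on {u..v} \<phi>" using \<phi>(1) uv by (elim continuous_on_subset) auto
    then obtain r where r: "u \<le> r" "r \<le> v" "\<phi> r = y"
      using IVT'[of \<phi> u y v] y uv by auto
    then have "g y = k r" using k(2)[of r] uv by simp
    then show "g y \<in> open_segment a b" using hits r y by auto
  qed
  ultimately show ?thesis unfolding crosses_def w prod.case using uv unfolding kuv by blast
qed

lemma crosses_subpath:
  assumes "crosses (subpath 0 t g) w" "t \<in> {0..1}"
  shows "crosses g w"
proof (rule crosses_reparametrization[OF assms(1), of g "\<lambda>r. t * r"])
  show "mono_on {0..1} ((*) t)" using assms(2) by (auto simp: mono_on_def mult_left_mono)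
  show "(*) t ` {0..1} \<subseteq> {0..1}" using assms(2) by (auto simp: mult_le_one)
qed (auto simp: subpath_def intro!: continuous_intros)

text \<open>The line through the wall is the zero set of the affine function \<open>f\<close>, and \<open>U\<close> is an open set
  that cuts the relative interior of the wall out of this line.\<close>

locale wall =
  fixes a b :: point and f :: "point \<Rightarrow> real" and U :: "point set"
  assumes line: "affine hull {a, b} = {x. f x = 0}"
    and interior: "open_segment a b = {x. f x = 0} \<inter> U"
    and open_U: "open U"
    and cont_f: "continuous_on UNIV f"
    and affine_f: "f ((1 - t) *\<^sub>R x + t *\<^sub>R y) = (1 - t) * f x + t * f y"

text \<open>In the plane a line is a hyperplane, which gives \<open>f\<close>; the relative interior
  of a segment is open in its affine hull, which gives \<open>U\<close>.\<close>

lemma wall_exists: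
  assumes "a \<noteq> b"
  obtains f U where "wall a b f U"
proof -
  have "aff_dim {a, b} = DIM(point) - 1" using assms by (simp add: aff_dim_2)
  then obtain n c where n: "affine hull {a, b} = {x. n \<bullet> x = c}"
    using aff_dim_eq_hyperplane[of "{a, b}"] by auto
  have "openin (top_of_set (affine hull (closed_segment a b))) (rel_interior (closed_segment a b))"
    by (rule openin_rel_interior)
  then obtain U where U: "open U" "open_segment a b = affine hull {a, b} \<inter> U"
    using assms by (auto simp: openin_open rel_interior_closed_segment affine_hull_closed_segment)
  have "wall a b (\<lambda>x. n \<bullet> x - c) U"
    using n U by unfold_locales (auto simp: inner_add_right algebra_simps intro!: continuous_intros)
  then show ?thesis by (rule that)
qed

section \<open>Crossings as sign changes of \<open>f\<close>\<close>

context wall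
begin

text \<open>Swaps the two sides of the wall, so that the target point may be taken on the positive
  one.\<close>

lemma wall_uminus: "wall a b (\<lambda>x. - f x) U"
  using line interior open_U cont_f affine_f
  by unfold_locales (auto simp: algebra_simps intro!: continuous_intros)

text \<open>An affine function with nonzero values at the ends of a segment vanishes on it exactly
  if these values have opposite signs. A negative product already excludes \<open>u = v\<close>,
  which permits the weak inequality.\<close>

lemma crosses_iff:
  "crosses g (a, b) \<longleftrightarrow> (\<exists>u v. 0 \<le> u \<and> u \<le> v \<and> v \<le> 1 \<and> f (g u) * f (g v) < 0 \<and>
     (\<forall>r\<in>{u..v}. f (g r) = 0 \<longrightarrow> g r \<in> U))"
proof -
  have opp: "(closed_segment x y \<inter> {x. f x = 0} \<noteq> {}) \<longleftrightarrow> f x * f y < 0"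
    if "f x \<noteq> 0" "f y \<noteq> 0" for x y
  proof
    assume "closed_segment x y \<inter> {x. f x = 0} \<noteq> {}"
    then obtain t where t: "0 \<le> t" "t \<le> 1" "(1 - t) * f x + t * f y = 0"
      by (auto simp: closed_segment_def affine_f)
    then have "t \<noteq> 0" "t \<noteq> 1" using that by auto
    then have "0 < t" "0 < 1 - t" using t by auto
    moreover have "(1 - t) * f x = - (t * f y)" using t by simp
    \<comment> \<open>The vanishing convex combination, multiplied by \<open>f y\<close>.\<close>
    ultimately have "(1 - t) * (f x * f y) = - t * (f y * f y)"
      using mult.assoc[of "1 - t" "f x" "f y"] by simp
    also have "\<dots> < 0" using \<open>0 < t\<close> that by (simp add: mult_pos_pos zero_less_mult_iff) linarith
    finally show "f x * f y < 0" using \<open>0 < 1 - t\<close> by (simp add: mult_less_0_iff)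
  next
    assume neg: "f x * f y < 0"
    \<comment> \<open>The zero of the affine interpolation between \<open>f x\<close> and
      \<open>f y\<close>.\<close>
    define t where "t = f x / (f x - f y)"
    have ne: "f x \<noteq> f y" using neg by (auto simp: mult_less_0_iff)
    have "0 \<le> t" "t \<le> 1" using neg by (auto simp: t_def mult_less_0_iff field_simps)
    moreover have "f ((1 - t) *\<^sub>R x + t *\<^sub>R y) = 0"
      unfolding affine_f using ne by (simp add: t_def field_simps)
    ultimately show "closed_segment x y \<inter> {x. f x = 0} \<noteq> {}"
      by (auto simp: closed_segment_def)
  qed
  have "crosses g (a, b) \<longleftrightarrow> (\<exists>u v. 0 \<le> u \<and> u < v \<and> v \<le> 1 \<and> f (g u) \<noteq> 0 \<and> f (g v) \<noteq> 0 \<and>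
     closed_segment (g u) (g v) \<inter> {x. f x = 0} \<noteq> {} \<and>
     (\<forall>r\<in>{u..v}. f (g r) = 0 \<longrightarrow> g r \<in> U))"
    unfolding crosses_def prod.case line interior by (intro ex_cong1) blast
  also have "\<dots> \<longleftrightarrow> (\<exists>u v. 0 \<le> u \<and> u \<le> v \<and> v \<le> 1 \<and> f (g u) * f (g v) < 0 \<and>
     (\<forall>r\<in>{u..v}. f (g r) = 0 \<longrightarrow> g r \<in> U))"
  proof (intro ex_cong1)
    fix u v
    have "f (g u) * f (g v) < 0 \<Longrightarrow> u \<noteq> v" by (auto simp: mult_less_0_iff)
    moreover have "f (g u) * f (g v) < 0 \<Longrightarrow> f (g u) \<noteq> 0 \<and> f (g v) \<noteq> 0" by auto
    ultimately show "(0 \<le> u \<and> u < v \<and> v \<le> 1 \<and> f (g u) \<noteq> 0 \<and> f (g v) \<noteq> 0 \<and>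
     closed_segment (g u) (g v) \<inter> {x. f x = 0} \<noteq> {} \<and>
     (\<forall>r\<in>{u..v}. f (g r) = 0 \<longrightarrow> g r \<in> U)) \<longleftrightarrow> (0 \<le> u \<and> u \<le> v \<and> v \<le> 1 \<and> f (g u) * f (g v) < 0 \<and>
     (\<forall>r\<in>{u..v}. f (g r) = 0 \<longrightarrow> g r \<in> U))"
      using opp[of "g u" "g v"] less_le[of u v] by blast
  qed
  finally show ?thesis .
qed

text \<open>If neither piece crosses alone, the crossing arc must contain the junction: it consists
  of a final arc of \<open>g1\<close> and an initial arc of \<open>g2\<close>.\<close>

lemma crosses_joinE:
  assumes "crosses (g1 +++ g2) (a, b)" "pathfinish g1 = pathstart g2"
    and "\<not> crosses g1 (a, b)" "\<not> crosses g2 (a, b)"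
  obtains u v where "0 \<le> u" "u \<le> 1" "0 \<le> v" "v \<le> 1" "f (g1 u) * f (g2 v) < 0"
    "\<And>r. u \<le> r \<Longrightarrow> r \<le> 1 \<Longrightarrow> f (g1 r) = 0 \<Longrightarrow> g1 r \<in> U"
    "\<And>r. 0 \<le> r \<Longrightarrow> r \<le> v \<Longrightarrow> f (g2 r) = 0 \<Longrightarrow> g2 r \<in> U"
proof -
  let ?h = "g1 +++ g2"
  have h1: "?h (r / 2) = g1 r" if "r \<le> 1" for r
    using that by (simp add: joinpaths_def)
  have h2: "?h ((r + 1) / 2) = g2 r" if "0 \<le> r" for r
  \<comment> \<open>At parameter 1/2 the join still evaluates \<open>g1\<close>, so here the
    matching of the endpoints is used.\<close>
  proof (cases "r = 0")
    case True then show ?thesis using assms(2) by (simp add: joinpaths_def pathstart_def pathfinish_def)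
  next
    case False then show ?thesis using that by (simp add: joinpaths_def add_divide_distrib)
  qed
  obtain u v where uv: "0 \<le> u" "u \<le> v" "v \<le> 1" "f (?h u) * f (?h v) < 0"
    and hits: "\<And>r. u \<le> r \<Longrightarrow> r \<le> v \<Longrightarrow> f (?h r) = 0 \<Longrightarrow> ?h r \<in> U"
    using assms(1) unfolding crosses_iff by auto
  consider "v \<le> 1/2" | "u \<le> 1/2" "v > 1/2" | "u > 1/2" by linarith
  then show ?thesis
  proof cases
    case 1
    have "0 \<le> 2 * u \<and> 2 * u \<le> 2 * v \<and> 2 * v \<le> 1 \<and> f (g1 (2 * u)) * f (g1 (2 * v)) < 0 \<and>
      (\<forall>r\<in>{2 * u..2 * v}. f (g1 r) = 0 \<longrightarrow> g1 r \<in> U)"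
      using 1 uv h1[of "2 * u"] h1[of "2 * v"] h1 hits[of "_ / 2"] by auto
    then show ?thesis using assms(3) unfolding crosses_iff by blast
  next
    case 2
    show ?thesis
    proof (rule that[of "2 * u" "2 * v - 1"])
      show "f (g1 (2 * u)) * f (g2 (2 * v - 1)) < 0"
        using uv 2 h1[of "2 * u"] h2[of "2 * v - 1"] by simp
      show "g1 r \<in> U" if "2 * u \<le> r" "r \<le> 1" "f (g1 r) = 0" for r
        using that 2 h1[of r] hits[of "r / 2"] by simp
      show "g2 r \<in> U" if "0 \<le> r" "r \<le> 2 * v - 1" "f (g2 r) = 0" for r
        using that 2 h2[of r] hits[of "(r + 1) / 2"] by simp
    qed (use 2 uv in auto)
  next
    case 3
    have "0 \<le> 2 * u - 1 \<and> 2 * u - 1 \<le> 2 * v - 1 \<and> 2 * v - 1 \<le> 1 \<and>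
      f (g2 (2 * u - 1)) * f (g2 (2 * v - 1)) < 0"
      using 3 uv h2[of "2 * u - 1"] h2[of "2 * v - 1"] by auto
    moreover have "g2 r \<in> U" if "2 * u - 1 \<le> r" "r \<le> 2 * v - 1" "f (g2 r) = 0" for r
      using that 3 h2[of r] hits[of "(r + 1) / 2"] by simp
    ultimately show ?thesis using assms(4) unfolding crosses_iff by (meson atLeastAtMost_iff)
  qed
qed

text \<open>A crossing arc would contain the junction. Outside the open wall the junction cannot lie
  on the line, so \<open>f\<close> has a sign there, opposite to its sign at one end of the arc;
  then one of the two pieces already crosses.\<close>

lemma not_crosses_join:
  assumes "pathfinish g1 = pathstart g2" "\<not> crosses g1 (a, b)" "\<not> crosses g2 (a, b)"
    and "pathstart g2 \<notin> open_segment a b"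
  shows "\<not> crosses (g1 +++ g2) (a, b)"
proof
  assume "crosses (g1 +++ g2) (a, b)"
  from crosses_joinE[OF this assms(1-3)] obtain u v
    where uv: "0 \<le> u" "u \<le> 1" "0 \<le> v" "v \<le> 1" "f (g1 u) * f (g2 v) < 0"
    and h1: "\<And>r. u \<le> r \<Longrightarrow> r \<le> 1 \<Longrightarrow> f (g1 r) = 0 \<Longrightarrow> g1 r \<in> U"
    and h2: "\<And>r. 0 \<le> r \<Longrightarrow> r \<le> v \<Longrightarrow> f (g2 r) = 0 \<Longrightarrow> g2 r \<in> U" by blast
  have eq: "g1 1 = g2 0" using assms(1) by (simp add: pathstart_def pathfinish_def)
  have "f (g2 0) \<noteq> 0" using h2[of 0] uv assms(4) by (auto simp: interior pathstart_def)
  then have "f (g1 u) * f (g1 1) < 0 \<or> f (g2 0) * f (g2 v) < 0"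
    using uv(5) unfolding eq by (auto simp: mult_less_0_iff)
  moreover have "\<not> f (g1 u) * f (g1 1) < 0"
    using assms(2) uv h1 unfolding crosses_iff by (meson atLeastAtMost_iff order_refl)
  moreover have "\<not> f (g2 0) * f (g2 v) < 0"
    using assms(3) uv h2 unfolding crosses_iff by (meson atLeastAtMost_iff order_refl)
  ultimately show False by blast
qed

text \<open>For \<open>f x\<close> \<le> 0 < \<open>f p\<close>, the point where the segment from
  \<open>x\<close> to \<open>p\<close> meets the line through the wall; the ratio is the zero of
  \<open>f\<close> along that segment.\<close>

definition foot :: "point \<Rightarrow> point \<Rightarrow> point" where
  "foot p x = (1 - f x / (f x - f p)) *\<^sub>R x + (f x / (f x - f p)) *\<^sub>R p"

lemma foot_eq_linepath: "foot p x = linepath x p (f x / (f x - f p))"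
  by (simp add: foot_def linepath_def)

lemma f_linepath: "f (linepath x p r) = f x + r * (f p - f x)"
  unfolding linepath_def affine_f by (simp add: algebra_simps)

lemma f_foot:
  assumes "f x \<le> 0" "0 < f p"
  shows "f (foot p x) = 0"
proof -
  have "f x - f p \<noteq> 0" using assms by auto
  then have "f x / (f x - f p) * (f p - f x) = - f x" by (simp add: field_simps)
  then show ?thesis unfolding foot_eq_linepath f_linepath by simp
qed

lemma foot_in_segment:
  assumes "f x \<le> 0" "0 < f p"
  shows "foot p x \<in> closed_segment x p"
proof -
  have "0 \<le> f x / (f x - f p)" "f x / (f x - f p) \<le> 1"
    using assms by (auto simp: zero_le_divide_iff divide_le_eq)
  then show ?thesis unfolding foot_def closed_segment_def by auto
qed

lemma foot_on_line: "f x = 0 \<Longrightarrow> foot p x = x"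
  by (simp add: foot_def)

text \<open>For \<open>p\<close> on the positive side, the path that follows \<open>g\<close> up to time \<open>t\<close> and then
  runs straight to \<open>p\<close> passes through the wall.\<close>

definition blocked :: "(real \<Rightarrow> point) \<Rightarrow> point \<Rightarrow> real \<Rightarrow> bool" where
  "blocked g p t \<longleftrightarrow> f (g t) \<le> 0 \<and> foot p (g t) \<in> U \<and>
     (\<exists>u\<in>{0..t}. f (g u) < 0 \<and> (\<forall>r\<in>{u..t}. f (g r) = 0 \<longrightarrow> g r \<in> U))"

text \<open>Expresses the arc given by \<open>crosses_joinE\<close> in the time of \<open>g\<close>.
  There is no sign change between \<open>u\<close> and \<open>t\<close>, since \<open>g\<close>
  itself would cross there.\<close>

lemma crosses_shortcutE:
  assumes "crosses (subpath 0 t g +++ linepath (g t) p) (a, b)"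
    and g: "\<not> crosses g (a, b)" and t: "t \<in> {0..1}"
    and lp: "\<not> crosses (linepath (g t) p) (a, b)"
  obtains u v where "u \<in> {0..t}" "v \<in> {0..1}" "f (g u) * f (linepath (g t) p v) < 0"
    "\<not> f (g u) * f (g t) < 0"
    "\<forall>r\<in>{u..t}. f (g r) = 0 \<longrightarrow> g r \<in> U"
    "\<And>r. 0 \<le> r \<Longrightarrow> r \<le> v \<Longrightarrow> f (linepath (g t) p r) = 0 \<Longrightarrow> linepath (g t) p r \<in> U"
proof -
  have "\<not> crosses (subpath 0 t g) (a, b)" using crosses_subpath g t by blast
  moreover have "pathfinish (subpath 0 t g) = pathstart (linepath (g t) p)" by simp
  ultimately obtain u v where uv: "0 \<le> u" "u \<le> 1" "0 \<le> v" "v \<le> 1"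
      "f (subpath 0 t g u) * f (linepath (g t) p v) < 0"
    and hg: "\<And>r. u \<le> r \<Longrightarrow> r \<le> 1 \<Longrightarrow> f (subpath 0 t g r) = 0 \<Longrightarrow> subpath 0 t g r \<in> U"
    and hl: "\<And>r. 0 \<le> r \<Longrightarrow> r \<le> v \<Longrightarrow> f (linepath (g t) p r) = 0 \<Longrightarrow> linepath (g t) p r \<in> U"
    using crosses_joinE[OF assms(1) _ _ lp] by metis
  have tu: "t * u \<in> {0..t}" using uv t mult_left_mono[of u 1 t] by auto
  have hits: "\<forall>r\<in>{t * u..t}. f (g r) = 0 \<longrightarrow> g r \<in> U"
  proof clarify
    fix r assume r: "r \<in> {t * u..t}" "f (g r) = 0"
    show "g r \<in> U"
    \<comment> \<open>For \<open>t = 0\<close> the first piece is constant and times cannot be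
      rescaled by \<open>t\<close>.\<close>
    proof (cases "t = 0")
      case True then show ?thesis using hg[of 1] r uv by (simp add: subpath_def)
    next
      case False
      then have "u \<le> r / t" "r / t \<le> 1" using r t by (auto simp: field_simps)
      then show ?thesis using hg[of "r / t"] r False by (simp add: subpath_def)
    qed
  qed
  show ?thesis
  proof (rule that[of "t * u" v])
    show "\<not> f (g (t * u)) * f (g t) < 0"
    proof
      assume "f (g (t * u)) * f (g t) < 0"
      then have "crosses g (a, b)"
        unfolding crosses_iff using tu t hits by (intro exI[of _ "t * u"] exI[of _ t]) auto
      then show False using g by simp
    qed
  qed (use uv tu hits hl in \<open>auto simp: subpath_def\<close>)
qed

text \<open>Along the straight piece \<open>f\<close> is affine and ends at \<open>f p\<close> > 0,
  so it can only change sign upwards. Either the straight piece crosses alone, and \<open>t\<close>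
  itself is the negative time required by \<open>blocked\<close>, or the crossing arc starts earlier
  on \<open>g\<close>. In both cases the arc contains the foot.\<close>

lemma crosses_shortcut_imp_blocked:
  assumes cr: "crosses (subpath 0 t g +++ linepath (g t) p) (a, b)"
    and g: "\<not> crosses g (a, b)" and t: "t \<in> {0..1}" and p: "0 < f p"
  shows "blocked g p t"
proof -
  let ?l = "linepath (g t) p" and ?s = "f (g t) / (f (g t) - f p)"
  have fl0: "f (?l r) \<ge> 0" if "f (g t) \<ge> 0" "r \<in> {0..1}" for r
  proof -
    have "f (?l r) = (1 - r) * f (g t) + r * f p" by (simp add: f_linepath algebra_simps)
    then show ?thesis using that p by simp
  qed
  \<comment> \<open>\<open>?s\<close> is the parameter of the foot, and \<open>f\<close> increases
    strictly along the straight piece.\<close>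
  have s_le: "?s \<le> r \<longleftrightarrow> 0 \<le> f (?l r)" "r \<le> ?s \<longleftrightarrow> f (?l r) \<le> 0" if "f (g t) \<le> 0" for r
    using that p by (auto simp: f_linepath field_simps)
  have foot: "f (?l ?s) = 0" if "f (g t) \<le> 0"
    using f_foot[OF that p] by (simp add: foot_eq_linepath)
  show ?thesis
  proof (cases "crosses ?l (a, b)")
    case True
    then obtain u v where uv: "0 \<le> u" "u \<le> v" "v \<le> 1" "f (?l u) * f (?l v) < 0"
      and hits: "\<And>r. u \<le> r \<Longrightarrow> r \<le> v \<Longrightarrow> f (?l r) = 0 \<Longrightarrow> ?l r \<in> U"
      unfolding crosses_iff by auto
    have neg: "f (g t) < 0"
    proof (rule ccontr)
      assume "\<not> f (g t) < 0"
      then have "f (?l u) * f (?l v) \<ge> 0" using fl0[of u] fl0[of v] uv by simp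
      then show False using uv by simp
    qed
    have "f (?l u) \<le> f (?l v)" using uv neg p by (simp add: f_linepath mult_right_mono)
    then have "f (?l u) < 0" "0 < f (?l v)" using uv by (auto simp: mult_less_0_iff)
    then have "foot p (g t) \<in> U"
      unfolding foot_eq_linepath using neg by (intro hits foot) (auto simp: s_le)
    then show ?thesis unfolding blocked_def using neg t by (intro conjI bexI[of _ t]) auto
  next
    case False
    from crosses_shortcutE[OF cr g t this] obtain u v
      where uv: "u \<in> {0..t}" "v \<in> {0..1}" "f (g u) * f (?l v) < 0" "\<not> f (g u) * f (g t) < 0"
        and hg: "\<forall>r\<in>{u..t}. f (g r) = 0 \<longrightarrow> g r \<in> U"
        and hl: "\<And>r. 0 \<le> r \<Longrightarrow> r \<le> v \<Longrightarrow> f (?l r) = 0 \<Longrightarrow> ?l r \<in> U" by metis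
    \<comment> \<open>If \<open>g t\<close> were on the positive side, \<open>?l v\<close> would be
      too, and \<open>g u\<close> on the negative side, which is a sign change within
      \<open>g\<close>.\<close>
    have gt: "f (g t) \<le> 0" using uv fl0[of v] by (auto simp: mult_less_0_iff)
    have gu: "f (g u) < 0" using uv fl0[of v] gt by (cases "f (g t) = 0") (auto simp: mult_less_0_iff)
    then have "0 < f (?l v)" using uv by (auto simp: mult_less_0_iff)
    moreover have "0 \<le> ?s" using s_le(2)[OF gt, of 0] gt by (simp add: f_linepath)
    ultimately have "foot p (g t) \<in> U"
      unfolding foot_eq_linepath using gt by (intro hl foot) (auto simp: s_le)
    then show ?thesis unfolding blocked_def using gt gu uv hg by blast
  qed
qed

text \<open>Along the straight piece \<open>f\<close> is \<open>f (g t)\<close> times a nonnegative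
  factor, so a sign change could be moved back to time \<open>t\<close>, where \<open>g\<close>
  itself would cross.\<close>

lemma not_crosses_shortcut_of_on_line:
  assumes g: "\<not> crosses g (a, b)" and t: "t \<in> {0..1}" and p: "f p = 0"
  shows "\<not> crosses (subpath 0 t g +++ linepath (g t) p) (a, b)"
proof
  assume cr: "crosses (subpath 0 t g +++ linepath (g t) p) (a, b)"
  let ?l = "linepath (g t) p"
  have fl: "f (?l r) = (1 - r) * f (g t)" for r
    by (simp add: f_linepath p algebra_simps)
  have "\<not> crosses ?l (a, b)"
  proof
    assume "crosses ?l (a, b)"
    then obtain u v where uv: "0 \<le> u" "u \<le> v" "v \<le> 1" "f (?l u) * f (?l v) < 0"
      unfolding crosses_iff by auto
    have "f (?l u) * f (?l v) = ((1 - u) * (1 - v)) * (f (g t) * f (g t))"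
      by (simp add: fl algebra_simps)
    also have "\<dots> \<ge> 0" using uv by (intro mult_nonneg_nonneg[OF _ zero_le_square]) simp
    finally show False using uv by simp
  qed
  from crosses_shortcutE[OF cr g t this] obtain u v
    where uv: "v \<in> {0..1}" "f (g u) * f (?l v) < 0" "\<not> f (g u) * f (g t) < 0" by metis
  have "f (g u) * f (?l v) = (1 - v) * (f (g u) * f (g t))" by (simp add: fl)
  also have "\<dots> \<ge> 0" using uv by (intro mult_nonneg_nonneg[of "1 - v"]) simp_all
  finally show False using uv by simp
qed

section \<open>The last time at which a shortcut is blocked\<close>

context
  fixes g :: "real \<Rightarrow> point" and p :: point
  assumes path_g: "path g" and finish_g: "pathfinish g = p" and p_pos: "0 < f p"
begin

lemma tendsto_f_g:
  assumes "t \<in> {0..1}"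
  shows "(g \<longlongrightarrow> g t) (at t within {0..1})" "((\<lambda>r. f (g r)) \<longlongrightarrow> f (g t)) (at t within {0..1})"
proof -
  show g: "(g \<longlongrightarrow> g t) (at t within {0..1})"
    using path_g assms by (auto simp: path_def continuous_on_def)
  have "isCont f (g t)" using cont_f by (simp add: continuous_on_eq_continuous_at)
  then show "((\<lambda>r. f (g r)) \<longlongrightarrow> f (g t)) (at t within {0..1})"
    using g by (rule isCont_tendsto_compose)
qed

lemma tendsto_foot_g:
  assumes "t \<in> {0..1}" "f (g t) \<le> 0"
  shows "((\<lambda>r. foot p (g r)) \<longlongrightarrow> foot p (g t)) (at t within {0..1})"
  unfolding foot_def using assms p_pos by (intro tendsto_intros tendsto_f_g) auto

text \<open>Collects the open conditions that persist around \<open>t\<close>. If \<open>g t\<close>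
  is on the line, it is its own foot, so \<open>g\<close> stays in \<open>U\<close> for a while; the
  sign of \<open>f\<close> is then not controlled.\<close>

lemma near_foot:
  assumes t: "t \<in> {0..1}" "f (g t) \<le> 0" "foot p (g t) \<in> U"
  obtains d where "0 < d" "\<And>r. r \<in> {0..1} \<Longrightarrow> \<bar>r - t\<bar> < d \<Longrightarrow>
     foot p (g r) \<in> U \<and> (f (g t) < 0 \<longrightarrow> f (g r) < 0) \<and> (f (g t) = 0 \<longrightarrow> g r \<in> U)"
proof -
  let ?F = "at t within {0..1}"
  have "\<forall>\<^sub>F r in ?F. foot p (g r) \<in> U"
    using tendsto_foot_g[OF t(1,2)] open_U t(3) by (rule topological_tendstoD)
  moreover have "\<forall>\<^sub>F r in ?F. f (g t) < 0 \<longrightarrow> f (g r) < 0"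
    using order_tendstoD(2)[OF tendsto_f_g(2)[OF t(1)], of 0] by (cases "f (g t) < 0") auto
  moreover have "\<forall>\<^sub>F r in ?F. f (g t) = 0 \<longrightarrow> g r \<in> U"
    using topological_tendstoD[OF tendsto_f_g(1)[OF t(1)] open_U] t(3) foot_on_line
    by (cases "f (g t) = 0") auto
  ultimately have "\<forall>\<^sub>F r in ?F. foot p (g r) \<in> U \<and> (f (g t) < 0 \<longrightarrow> f (g r) < 0) \<and>
     (f (g t) = 0 \<longrightarrow> g r \<in> U)" by eventually_elim auto
  then obtain d where "0 < d" and d: "\<And>r. r \<in> {0..1} \<Longrightarrow> r \<noteq> t \<Longrightarrow> dist r t < d \<Longrightarrow>
     foot p (g r) \<in> U \<and> (f (g t) < 0 \<longrightarrow> f (g r) < 0) \<and> (f (g t) = 0 \<longrightarrow> g r \<in> U)"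
    unfolding eventually_at by blast
  moreover have "f (g t) = 0 \<longrightarrow> g t \<in> U" using t foot_on_line by auto
  ultimately show ?thesis using t that[of d] by (metis dist_real_def)
qed

text \<open>A straight continuation that is blocked stays blocked for a while: otherwise \<open>g\<close> itself
  would pass through the wall.\<close>

lemma blocked_right:
  assumes t: "t \<in> {0..1}" "blocked g p t" and ncr: "\<not> crosses g (a, b)"
  obtains t' where "t < t'" "t' \<in> {0..1}" "blocked g p t'"
proof -
  obtain u where u: "u \<in> {0..t}" "f (g u) < 0" "\<forall>r\<in>{u..t}. f (g r) = 0 \<longrightarrow> g r \<in> U"
    and b: "f (g t) \<le> 0" "foot p (g t) \<in> U" using t unfolding blocked_def by blast
  obtain d where "0 < d" and d: "\<And>r. r \<in> {0..1} \<Longrightarrow> \<bar>r - t\<bar> < d \<Longrightarrow>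
     foot p (g r) \<in> U \<and> (f (g t) < 0 \<longrightarrow> f (g r) < 0) \<and> (f (g t) = 0 \<longrightarrow> g r \<in> U)"
    using near_foot[OF t(1) b] by metis
  \<comment> \<open>At time 1 the path is at \<open>p\<close>, on the positive side, so there is
    room to the right of \<open>t\<close>.\<close>
  have "t \<noteq> 1" using b p_pos finish_g by (auto simp: pathfinish_def)
  define t' where "t' = min 1 (t + d / 2)"
  have t': "t < t'" "t' \<in> {0..1}" "\<And>r. r \<in> {t..t'} \<Longrightarrow> r \<in> {0..1} \<and> \<bar>r - t\<bar> < d"
    using \<open>0 < d\<close> \<open>t \<noteq> 1\<close> t(1) by (auto simp: t'_def)
  have "blocked g p t'"
  proof (cases "f (g t) < 0")
    case True
    then have "f (g t') < 0" "foot p (g t') \<in> U" using d[of t'] t'(1) t'(3)[of t'] by auto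
    then show ?thesis unfolding blocked_def using t' by (intro conjI bexI[of _ t']) auto
  next
    case False
    then have nU: "g r \<in> U" if "r \<in> {t..t'}" for r using d[of r] t'(3)[OF that] b by auto
    have hits: "\<forall>r\<in>{u..t'}. f (g r) = 0 \<longrightarrow> g r \<in> U"
      using u(3) nU by (metis atLeastAtMost_iff linear)
    \<comment> \<open>From \<open>u\<close> to \<open>t'\<close> the path meets the line only inside
      the wall, so reaching the positive side would be a crossing of \<open>g\<close>.\<close>
    have "\<not> f (g u) * f (g t') < 0"
    proof
      assume "f (g u) * f (g t') < 0"
      then have "crosses g (a, b)"
        unfolding crosses_iff using u(1) t' hits by (intro exI[of _ u] exI[of _ t']) auto
      then show False using ncr by simp
    qed
    then have "f (g t') \<le> 0" using u(2) by (auto simp: mult_less_0_iff)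
    moreover have "foot p (g t') \<in> U" using d[of t'] t'(1) t'(3)[of t'] by auto
    ultimately show ?thesis unfolding blocked_def using u hits t'(1) by (intro conjI bexI[of _ u]) auto
  qed
  then show ?thesis using t' that by blast
qed

text \<open>The supremum \<open>T\<close> of the blocked times is not blocked, by
  \<open>blocked_right\<close>. The foot at \<open>T\<close> is a limit of points of the open wall,
  hence in the closed wall; in the open wall it would make \<open>T\<close> blocked, so it is an
  endpoint.\<close>

lemma last_blocked_time:
  assumes ncr: "\<not> crosses g (a, b)" and ne: "t0 \<in> {0..1}" "blocked g p t0"
  obtains T where "T \<in> {0..1}" "\<And>t. t \<in> {T..1} \<Longrightarrow> \<not> blocked g p t"
    "f (g T) \<le> 0" "foot p (g T) \<in> {a, b}"
proof -
  define B where "B = {t \<in> {0..1}. blocked g p t}"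
  define T where "T = Sup B"
  have B: "B \<noteq> {}" "bdd_above B" using ne by (auto simp: B_def intro!: bdd_aboveI[of _ 1])
  have up: "t \<le> T" if "t \<in> B" for t using that B unfolding T_def by (intro cSup_upper)
  have T1: "T \<le> 1" unfolding T_def using B by (intro cSup_least) (auto simp: B_def)
  have T01: "T \<in> {0..1}" using up[of t0] ne T1 by (auto simp: B_def)
  have nT: "\<not> blocked g p T"
  proof
    assume "blocked g p T"
    then obtain t' where "T < t'" "t' \<in> B" using blocked_right[OF T01 _ ncr] unfolding B_def by blast
    then show False using up[of t'] by simp
  qed
  have "T \<in> closure B" unfolding T_def using B by (intro closure_contains_Sup)
  then obtain x where x: "\<And>n. x n \<in> B" "x \<longlonglongrightarrow> T" unfolding closure_sequential by blast
  \<comment> \<open>Needed because the limits of \<open>f\<close> and \<open>foot\<close> along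
    \<open>g\<close> are taken in punctured neighbourhoods.\<close>
  have "x n \<noteq> T" for n using x(1)[of n] nT by (auto simp: B_def)
  then have lim: "filterlim x (at T within {0..1}) sequentially"
    using x by (auto simp: filterlim_at B_def)
  have fT: "f (g T) \<le> 0"
    using filterlim_compose[OF tendsto_f_g(2)[OF T01] lim] x(1)
    by (intro LIMSEQ_le_const2[of "\<lambda>n. f (g (x n))"]) (auto simp: B_def blocked_def)
  have "foot p (g (x n)) \<in> closed_segment a b" for n
  proof -
    have "blocked g p (x n)" using x(1) by (simp add: B_def)
    then have "foot p (g (x n)) \<in> open_segment a b"
      using f_foot p_pos unfolding interior blocked_def by auto
    then show ?thesis using segment_open_subset_closed by blast
  qed
  then have "foot p (g T) \<in> closed_segment a b"
    using filterlim_compose[OF tendsto_foot_g[OF T01 fT] lim]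
    by (rule closed_sequentially[OF closed_segment])
  moreover have "foot p (g T) \<notin> U"
  proof
    assume fU: "foot p (g T) \<in> U"
    obtain d where "0 < d" and d: "\<And>r. r \<in> {0..1} \<Longrightarrow> \<bar>r - T\<bar> < d \<Longrightarrow>
       foot p (g r) \<in> U \<and> (f (g T) < 0 \<longrightarrow> f (g r) < 0) \<and> (f (g T) = 0 \<longrightarrow> g r \<in> U)"
      using near_foot[OF T01 fT fU] by metis
    obtain t where t: "t \<in> B" "T - d < t"
      using less_cSupD[OF B(1), of "T - d"] \<open>0 < d\<close> unfolding T_def by auto
    then obtain u where u: "u \<in> {0..t}" "f (g u) < 0" "\<forall>r\<in>{u..t}. f (g r) = 0 \<longrightarrow> g r \<in> U"
      unfolding B_def blocked_def by blast
    have "blocked g p T"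
    proof (cases "f (g T) < 0")
      case True
      then show ?thesis unfolding blocked_def using T01 fU by (intro conjI bexI[of _ T]) auto
    next
      case False
      \<comment> \<open>Here \<open>g T\<close> is on the line and \<open>g\<close> stays in
        \<open>U\<close> from \<open>t\<close> to \<open>T\<close>, so the negative time
        \<open>u\<close> of \<open>t\<close> also serves \<open>T\<close>.\<close>
      have "g r \<in> U" if "r \<in> {t..T}" for r
        using d[of r] that t up[OF t(1)] T1 False fT by (auto simp: B_def)
      then have "\<forall>r\<in>{u..T}. f (g r) = 0 \<longrightarrow> g r \<in> U"
        using u(3) by (metis atLeastAtMost_iff linear)
      then show ?thesis unfolding blocked_def using u fT fU up[OF t(1)]
        by (intro conjI bexI[of _ u]) auto
    qed
    then show False using nT by simp
  qed
  moreover have "open_segment a b = closed_segment a b - {a, b}" by (simp add: open_segment_def)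
  ultimately have "foot p (g T) \<in> {a, b}"
    using f_foot[OF fT p_pos] interior by blast
  moreover have "\<not> blocked g p t" if "t \<in> {T..1}" for t
    using that up[of t] nT T01 by (cases "t = T") (auto simp: B_def)
  ultimately show ?thesis using that[of T] T01 fT by blast
qed

end

end

section \<open>The last vertex of a shortened path\<close>

text \<open>Replacing \<open>f\<close> by its negative puts \<open>p\<close> on the positive side;
  \<open>p\<close> is not on the line, as no shortcut would cross then. For the same reason
  \<open>e\<close>, which lies on the line, differs from \<open>p\<close>.\<close>

lemma last_crossing_shortcut:
  assumes "a \<noteq> b" and g: "path g" "pathfinish g = p" "\<not> crosses g (a, b)"
    and t0: "t0 \<in> {0..1}" "crosses (subpath 0 t0 g +++ linepath (g t0) p) (a, b)"
  obtains T e where "T \<in> {0..1}" "e \<in> {a, b}" "e \<in> closed_segment (g T) p" "e \<noteq> p"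
    "\<And>t. t \<in> {T..1} \<Longrightarrow> \<not> crosses (subpath 0 t g +++ linepath (g t) p) (a, b)"
proof -
  obtain f U where W: "wall a b f U" using wall_exists assms(1) by blast
  note result = that
  have *: thesis if W: "wall a b f U" and pos: "0 < f p" for f
  proof -
    interpret wall a b f U by fact
    have "blocked g p t0" using crosses_shortcut_imp_blocked t0 g pos by blast
    then obtain T where T: "T \<in> {0..1}" "\<And>t. t \<in> {T..1} \<Longrightarrow> \<not> blocked g p t"
      "f (g T) \<le> 0" "foot p (g T) \<in> {a, b}"
      using last_blocked_time[OF g(1,2) pos g(3) t0(1)] by metis
    show thesis
    proof (rule result[of T "foot p (g T)"])
      show "foot p (g T) \<noteq> p" using f_foot[OF T(3) pos] pos by auto
      show "\<not> crosses (subpath 0 t g +++ linepath (g t) p) (a, b)" if "t \<in> {T..1}" for t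
        using crosses_shortcut_imp_blocked[of t g p] T(1) T(2)[OF that] that g(3) pos by auto
    qed (use T pos foot_in_segment in auto)
  qed
  have "f p \<noteq> 0" using wall.not_crosses_shortcut_of_on_line[OF W g(3) t0(1)] t0(2) by blast
  then consider "0 < f p" | "0 < - f p" by linarith
  then show thesis using * W wall.wall_uminus[OF W] by cases blast+
qed

text \<open>Used in contrapositive form: every point on the straight part of an avoiding shortcut
  sees \<open>p\<close>. The map \<open>\<phi>\<close> runs affinely from the parameter of that
  point to 1.\<close>

lemma crosses_linepath_imp_crosses_join:
  assumes "crosses (linepath (linepath x p c) p) w" "pathfinish g = x" "c \<in> {0..1}"
  shows "crosses (g +++ linepath x p) w"
proof (rule crosses_reparametrization[OF assms(1), of _ "\<lambda>r. 1/2 + (c + (1 - c) * r) / 2"])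
  have c: "0 \<le> c" "c \<le> 1" using assms(3) by auto
  fix r :: real assume r: "r \<in> {0..1}"
  have nn: "0 \<le> c + (1 - c) * r" using c r by simp
  have "(g +++ linepath x p) (1/2 + \<sigma> / 2) = linepath x p \<sigma>" if "0 \<le> \<sigma>" for \<sigma>
    using that assms(2) by (cases "\<sigma> = 0") (auto simp: joinpaths_def pathfinish_def linepath_0')
  from this[OF nn] show "linepath (linepath x p c) p r = (g +++ linepath x p) (1/2 + (c + (1 - c) * r) / 2)"
    by (simp add: linepath_def algebra_simps)
next
  have c: "0 \<le> c" "c \<le> 1" using assms(3) by auto
  show "mono_on {0..1} (\<lambda>r. 1/2 + (c + (1 - c) * r) / 2)"
    using c by (auto simp: mono_on_def mult_left_mono)
  have "1/2 + (c + (1 - c) * r) / 2 \<in> {0..1}" if "r \<in> {0..1}" for r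
  proof -
    have "0 \<le> c + (1 - c) * r" "c + (1 - c) * r \<le> 1"
      using c that mult_left_mono[of r 1 "1 - c"] by auto
    moreover have "1/2 + y / 2 \<in> {0..1}" if "0 \<le> y" "y \<le> 1" for y :: real
      using that by simp
    ultimately show ?thesis by blast
  qed
  then show "(\<lambda>r. 1/2 + (c + (1 - c) * r) / 2) ` {0..1} \<subseteq> {0..1}"
    by blast
qed (auto intro!: continuous_intros)

text \<open>Used in contrapositive form: an avoiding shortcut may be stopped at any point of its
  straight part. The map \<open>\<phi>\<close> is the identity on the first half and slowed by the
  factor \<open>c\<close> on the second.\<close>

lemma crosses_join_linepath_prefix:
  assumes "crosses (g +++ linepath x (linepath x p c)) w" "pathfinish g = x" "c \<in> {0..1}"
  shows "crosses (g +++ linepath x p) w"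
proof (rule crosses_reparametrization[OF assms(1), of _ "\<lambda>r. min r (1/2) + c * max 0 (r - 1/2)"])
  have c: "0 \<le> c" "c \<le> 1" using assms(3) by auto
  fix r :: real assume r: "r \<in> {0..1}"
  show "(g +++ linepath x (linepath x p c)) r =
      (g +++ linepath x p) (min r (1/2) + c * max 0 (r - 1/2))"
  proof (cases "r \<le> 1/2")
    case True then show ?thesis by (simp add: joinpaths_def)
  next
    case False
    have "(g +++ linepath x p) (1/2 + \<sigma> / 2) = linepath x p \<sigma>" if "0 \<le> \<sigma>" for \<sigma>
      using that assms(2) by (cases "\<sigma> = 0") (auto simp: joinpaths_def pathfinish_def linepath_0')
    moreover have "1/2 + c * (r - 1/2) = 1/2 + c * (2 * r - 1) / 2" by (simp add: field_simps)
    ultimately have "(g +++ linepath x p) (1/2 + c * (r - 1/2)) = linepath x p (c * (2 * r - 1))"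
      using False c by (simp only: mult_nonneg_nonneg)
    then show ?thesis using False by (simp add: joinpaths_def linepath_def algebra_simps)
  qed
next
  have c: "0 \<le> c" "c \<le> 1" using assms(3) by auto
  show "mono_on {0..1} (\<lambda>r. min r (1/2) + c * max 0 (r - 1/2))"
    using c by (intro mono_onI add_mono mult_left_mono) auto
  have "min r (1/2) + c * max 0 (r - 1/2) \<in> {0..1}" if "r \<in> {0..1}" for r
  proof -
    have "0 \<le> c * max 0 (r - 1/2)" "c * max 0 (r - 1/2) \<le> max 0 (r - 1/2)"
      using c mult_left_le_one_le[of "max 0 (r - 1/2)" c] by auto
    then show ?thesis using that unfolding atLeastAtMost_iff by linarith
  qed
  then show "(\<lambda>r. min r (1/2) + c * max 0 (r - 1/2)) ` {0..1} \<subseteq> {0..1}"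
    by blast
qed (auto intro!: continuous_intros)

lemma visible_last_vertex:
  assumes \<O>: "segment_obstacles \<O>" and g: "g \<in> avoiding_paths \<O> s p" and "s \<noteq> p"
    and L: "curve_length g \<le> ereal L"
  obtains e where "e \<in> insert s (endpoints \<O>)" "e \<noteq> p" "visible \<O> e p"
    "obstacle_dist \<O> s e + ereal (dist e p) \<le> ereal L"
proof -
  note result = that
  let ?h = "\<lambda>t. subpath 0 t g +++ linepath (g t) p"
  have pg: "path g" "pathstart g = s" "pathfinish g = p" "\<And>w. w \<in> \<O> \<Longrightarrow> \<not> crosses g w"
    using g by (auto simp: avoiding_paths_def)
  have g01: "g 0 = s" "g 1 = p" using pg by (auto simp: pathstart_def pathfinish_def)
  have fin: "finite \<O>" and ne: "\<And>a b. (a, b) \<in> \<O> \<Longrightarrow> a \<noteq> b"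
    using \<O> by (auto simp: segment_obstacles_def)
  obtain V where V: "V 1 - V 0 \<le> L"
    "\<And>x y. 0 \<le> x \<Longrightarrow> x \<le> y \<Longrightarrow> y \<le> 1 \<Longrightarrow> dist (g x) (g y) \<le> V y - V x"
    using variation_of_rectifiable[OF L] by blast
  \<comment> \<open>Any point \<open>e\<close> on the straight part of an avoiding shortcut can be
    the last vertex: the part before \<open>e\<close> bounds the distance from \<open>s\<close>, the
    part after it is a line of sight.\<close>
  have via: ?thesis
    if T: "T \<in> {0..1}" "\<And>w. w \<in> \<O> \<Longrightarrow> \<not> crosses (?h T) w"
      and e: "e \<in> insert s (endpoints \<O>)" "e \<noteq> p" "e \<in> closed_segment (g T) p" for T e
  proof (rule result[OF e(1,2)])
    obtain c where c: "c \<in> {0..1}" "e = linepath (g T) p c"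
      using e(3) by (auto simp: closed_segment_def linepath_def)
    show "visible \<O> e p"
      unfolding visible_def c(2)
      using crosses_linepath_imp_crosses_join[of "g T" p c _ "subpath 0 T g"] T(2) c(1) by auto
    let ?k = "subpath 0 T g +++ linepath (g T) e"
    have "path (subpath 0 T g)" using pg(1) T(1) by (intro path_subpath) auto
    then have "?k \<in> avoiding_paths \<O> s e"
      unfolding avoiding_paths_def
      using crosses_join_linepath_prefix[of "subpath 0 T g" "g T" p c] T c g01 by (auto)
    moreover have "curve_length ?k \<le> ereal (V T - V 0 + dist (g T) e)"
      using T(1) V(2) by (intro curve_length_join_linepath) auto
    ultimately have "obstacle_dist \<O> s e \<le> ereal (V T - V 0 + dist (g T) e)"
      by (rule obstacle_dist_le)
    then have "obstacle_dist \<O> s e + ereal (dist e p) \<le> ereal (V T - V 0 + dist (g T) e) + ereal (dist e p)"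
      by (rule add_right_mono)
    also have "\<dots> = ereal (V T - V 0 + (dist (g T) e + dist e p))" by simp
    also have "dist (g T) e + dist e p = dist (g T) p"
      using e(3) by (metis between between_mem_segment)
    also have "ereal (V T - V 0 + dist (g T) p) \<le> ereal L"
      using V(1) V(2)[of T 1] T(1) g01 by simp
    finally show "obstacle_dist \<O> s e + ereal (dist e p) \<le> ereal L" .
  qed
  define W where "W = {w \<in> \<O>. \<exists>t\<in>{0..1}. crosses (?h t) w}"
  show ?thesis
  proof (cases "W = {}")
    case True
    \<comment> \<open>The shortcut at time 0 runs straight from \<open>s\<close> to
      \<open>p\<close>, so \<open>s\<close> is the last vertex.\<close>
    then show ?thesis using via[of 0 s] assms(3) g01 by (auto simp: W_def)
  next
    case False
    have "\<exists>T e. T \<in> {0..1} \<and> e \<in> endpoints \<O> \<and> e \<in> closed_segment (g T) p \<and> e \<noteq> p \<and>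
      (\<forall>t\<in>{T..1}. \<not> crosses (?h t) w)" if "w \<in> W" for w
    proof -
      obtain a b where w: "w = (a, b)" by fastforce
      obtain t0 where t0: "t0 \<in> {0..1}" "crosses (?h t0) (a, b)" and wO: "(a, b) \<in> \<O>"
        using \<open>w \<in> W\<close> w by (auto simp: W_def)
      have "{a, b} \<subseteq> endpoints \<O>" using wO by (force simp: endpoints_def)
      then show ?thesis
        using last_crossing_shortcut[OF ne[OF wO] pg(1,3) pg(4)[OF wO] t0] unfolding w
        by (metis subsetD)
    qed
    then obtain T where T: "\<And>w. w \<in> W \<Longrightarrow> T w \<in> {0..1} \<and>
        (\<exists>e. e \<in> endpoints \<O> \<and> e \<in> closed_segment (g (T w)) p \<and> e \<noteq> p) \<and>
        (\<forall>t\<in>{T w..1}. \<not> crosses (?h t) w)"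
      by metis
    have fW: "finite W" using fin by (simp add: W_def)
    \<comment> \<open>The wall that is crossed latest: from its time on, the shortcuts avoid all
      walls at once, and its endpoint lies on the shortcut at that time.\<close>
    obtain w where w: "w \<in> W" "T w = Max (T ` W)"
      using Max_in[of "T ` W"] fW False by (metis (no_types, lifting) finite_imageI image_iff image_is_empty)
    have "\<not> crosses (?h (T w)) w'" if "w' \<in> \<O>" for w'
    proof (cases "w' \<in> W")
      case True
      then have "T w' \<le> T w" using w(2) fW by simp
      then show ?thesis using T[OF True] T[OF w(1)] by auto
    next
      case False then show ?thesis using that T[OF w(1)] by (auto simp: W_def)
    qed
    then show ?thesis using via[of "T w"] T[OF w(1)] by blast
  qed
qed

text \<open>Two avoiding paths joined at an interior point of a wall may cross it. At an endpoint
  this cannot happen: it is outside the open segment of its own wall and, by disjointness, off all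
  others.\<close>

lemma obstacle_dist_triangle:
  assumes \<O>: "segment_obstacles \<O>" and e: "e \<in> endpoints \<O>" and vis: "visible \<O> e q"
  shows "obstacle_dist \<O> s q \<le> obstacle_dist \<O> s e + ereal (dist e q)"
proof -
  \<comment> \<open>Moving the distance to the left leaves a lower bound for all path lengths, to be
    compared with their infimum.\<close>
  have "obstacle_dist \<O> s q - ereal (dist e q) \<le> curve_length g" if g: "g \<in> avoiding_paths \<O> s e" for g
  proof (cases "curve_length g")
    case (real L)
    then obtain V where V: "V 1 - V 0 \<le> L"
      "\<And>x y. 0 \<le> x \<Longrightarrow> x \<le> y \<Longrightarrow> y \<le> 1 \<Longrightarrow> dist (g x) (g y) \<le> V y - V x"
      using variation_of_rectifiable[of g L] by auto
    have pg: "path g" "pathstart g = s" "pathfinish g = e" "\<And>w. w \<in> \<O> \<Longrightarrow> \<not> crosses g w"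
      using g by (auto simp: avoiding_paths_def)
    let ?h = "g +++ linepath e q"
    have "\<not> crosses ?h w" if "w \<in> \<O>" for w
    proof -
      obtain a b where w: "w = (a, b)" by fastforce
      have "a \<noteq> b" using \<O> that w by (auto simp: segment_obstacles_def)
      then obtain f U where "wall a b f U" by (rule wall_exists)
      moreover have "e \<notin> open_segment a b"
      proof
        assume eo: "e \<in> open_segment a b"
        obtain c d where cd: "(c, d) \<in> \<O>" "e = c \<or> e = d" using e by (auto simp: endpoints_def)
        have "(c, d) \<noteq> (a, b)" using cd eo by (auto simp: open_segment_def)
        then have "disjnt (closed_segment c d) (closed_segment a b)"
          using \<O> cd(1) that w unfolding segment_obstacles_def pairwise_def by fast
        moreover have "e \<in> closed_segment c d" using cd by auto
        moreover have "e \<in> closed_segment a b" using eo by (simp add: open_segment_def)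
        ultimately show False by (auto simp: disjnt_iff)
      qed
      ultimately show ?thesis
        using wall.not_crosses_join[of a b f U g "linepath e q"] pg vis that w
        by (auto simp: visible_def)
    qed
    then have "?h \<in> avoiding_paths \<O> s q" using pg by (auto simp: avoiding_paths_def)
    moreover have "curve_length ?h \<le> ereal (L + dist e q)"
    proof -
      have "g 1 = e" using pg by (simp add: pathfinish_def)
      then have "curve_length ?h \<le> ereal (V 1 - V 0 + dist e q)"
        using curve_length_join_linepath[of 1 g V q] V(2) by simp
      also have "\<dots> \<le> ereal (L + dist e q)" using V(1) by simp
      finally show ?thesis .
    qed
    ultimately have "obstacle_dist \<O> s q \<le> ereal (L + dist e q)" by (rule obstacle_dist_le)
    then show ?thesis using real by (simp add: ereal_minus_le_iff add.commute)
  qed (use curve_length_nonneg[of g] in auto)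
  then have "obstacle_dist \<O> s q - ereal (dist e q) \<le> obstacle_dist \<O> s e"
    unfolding obstacle_dist_def[of _ _ e] by (rule INF_greatest)
  then show ?thesis by (simp add: ereal_minus_le_iff add.commute)
qed

lemma obstacle_dist_le_dist:
  assumes "visible \<O> p q"
  shows "obstacle_dist \<O> p q \<le> ereal (dist p q)"
proof (rule obstacle_dist_le[OF _ curve_length_linepath])
  show "linepath p q \<in> avoiding_paths \<O> p q"
    using assms by (auto simp: avoiding_paths_def visible_def)
qed

text \<open>The last vertex depends on the path, but the least cost over all candidates bounds every
  path length from below. With finitely many candidates it is attained, so no shortest path has to
  be constructed.\<close>

lemma obstacle_dist_via_vertex:
  assumes \<O>: "segment_obstacles \<O>" and "s \<noteq> p" and l: "obstacle_dist \<O> s p \<le> ereal l"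
  obtains e where "e \<in> insert s (endpoints \<O>)" "e \<noteq> p" "visible \<O> e p"
    "obstacle_dist \<O> s e + ereal (dist e p) \<le> ereal l"
proof -
  let ?E = "{e \<in> insert s (endpoints \<O>). e \<noteq> p \<and> visible \<O> e p}"
    and ?c = "\<lambda>e. obstacle_dist \<O> s e + ereal (dist e p)"
  have fin: "finite ?E" using \<O> by (simp add: segment_obstacles_def endpoints_def)
  have "(INF e\<in>?E. ?c e) \<le> obstacle_dist \<O> s p"
    unfolding obstacle_dist_def[of \<O> s p]
  proof (rule INF_greatest)
    fix g assume g: "g \<in> avoiding_paths \<O> s p"
    show "(INF e\<in>?E. ?c e) \<le> curve_length g"
    proof (cases "curve_length g")
      case (real L)
      then show ?thesis
        using visible_last_vertex[OF \<O> g \<open>s \<noteq> p\<close>, of L]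
        by (metis (mono_tags, lifting) INF_lower2 mem_Collect_eq order_refl)
    qed (use curve_length_nonneg[of g] in auto)
  qed
  then have INF: "(INF e\<in>?E. ?c e) \<le> ereal l" using l by (rule order_trans)
  \<comment> \<open>An empty infimum would be infinite, contradicting the real bound
    \<open>l\<close>.\<close>
  have "?E \<noteq> {}"
  proof
    assume "?E = {}"
    then have "(INF e\<in>?E. ?c e) = \<infinity>" by (simp only: image_empty Inf_empty top_ereal_def)
    then show False using INF by simp
  qed
  then have "(INF e\<in>?E. ?c e) \<in> ?c ` ?E"
    using fin Min_in[of "?c ` ?E"] by (simp add: Min_Inf)
  then show thesis using INF that by fastforce
qed

theorem theorem1:
  fixes \<O> :: "obstacle set" and s :: point and l :: real
  assumes "segment_obstacles \<O>" and "l > 0"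
  shows "achievable_region \<O> s l =
    (\<Union>e\<in>effective_endpoints \<O> s l.
       circular_visibility_region \<O> e (l - real_of_ereal (obstacle_dist \<O> s e)))
    \<union> circular_visibility_region \<O> s l"
proof (intro equalityI subsetI)
  let ?d = "obstacle_dist \<O> s"
  \<comment> \<open>\<open>real_of_ereal\<close> sends infinite values to 0, so finiteness must be
    known before the radius can be used.\<close>
  have real_d: "?d e = ereal (real_of_ereal (?d e))" if "?d e \<le> ereal c" for e c
    using that obstacle_dist_nonneg[of \<O> s e] by (cases "?d e") auto
  {
    fix p assume "p \<in> achievable_region \<O> s l"
    then have p: "?d p \<le> ereal l" by (simp add: achievable_region_def)
    show "p \<in> (\<Union>e\<in>effective_endpoints \<O> s l.
       circular_visibility_region \<O> e (l - real_of_ereal (?d e))) \<union> circular_visibility_region \<O> s l"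
    proof (cases "s = p")
      case True
      have "visible \<O> p p" by (auto simp: visible_def crosses_linepath_iff)
      then show ?thesis using True assms(2) by (simp add: circular_visibility_region_def)
    next
      case False
      from obstacle_dist_via_vertex[OF assms(1) False p] obtain e
        where e: "e \<in> insert s (endpoints \<O>)" "e \<noteq> p" "visible \<O> e p"
          and le: "?d e + ereal (dist e p) \<le> ereal l" by metis
      define r where "r = real_of_ereal (?d e)"
      have "?d e \<le> ereal l"
        using le by (metis add_increasing2 ereal_less_eq(5) order_trans zero_le_dist add.right_neutral add_left_mono)
      then have r: "?d e = ereal r" using real_d by (simp add: r_def)
      then have rl: "r + dist e p \<le> l" "0 \<le> r" using le obstacle_dist_nonneg[of \<O> s e] by auto
      show ?thesis
      proof (cases "e = s")
        case True
        then show ?thesis using e rl by (simp add: circular_visibility_region_def)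
      next
        case False
        \<comment> \<open>Since \<open>e\<close> differs from \<open>p\<close>, its distance from
          \<open>s\<close> is strictly below \<open>l\<close>, as an effective endpoint
          requires.\<close>
        have "0 < dist e p" using e(2) by simp
        then have "r < l" using rl by linarith
        then have "e \<in> effective_endpoints \<O> s l"
          using False e(1) r by (simp add: effective_endpoints_def)
        moreover have "p \<in> circular_visibility_region \<O> e (l - real_of_ereal (?d e))"
          using e rl by (simp add: circular_visibility_region_def flip: r_def)
        ultimately show ?thesis by blast
      qed
    qed
  }
  {
    fix q assume "q \<in> (\<Union>e\<in>effective_endpoints \<O> s l.
       circular_visibility_region \<O> e (l - real_of_ereal (?d e))) \<union> circular_visibility_region \<O> s l"
    then consider e where "e \<in> endpoints \<O>" "?d e < ereal l" "visible \<O> e q"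
        "dist e q \<le> l - real_of_ereal (?d e)"
      | "visible \<O> s q" "dist s q \<le> l"
      by (auto simp: effective_endpoints_def circular_visibility_region_def)
    then have "?d q \<le> ereal l"
    proof cases
      case 1
      have "?d q \<le> ?d e + ereal (dist e q)" using obstacle_dist_triangle[OF assms(1) 1(1,3)] .
      also have "\<dots> = ereal (real_of_ereal (?d e) + dist e q)"
        using real_d[of e l] 1(2) by (metis less_imp_le plus_ereal.simps(1))
      also have "\<dots> \<le> ereal l" using 1(4) by simp
      finally show ?thesis .
    next
      case 2
      then show ?thesis using obstacle_dist_le_dist[of \<O> s q] by (metis ereal_less_eq(3) order_trans)
    qed
    then show "q \<in> achievable_region \<O> s l" by (simp add: achievable_region_def)
  }
qed

end
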